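(* Let $n\ge 2$ and let $u=s_{1,i_1}s_{2,i_2}\cdots s_{n-1,i_{n-1}}\in S_n$ (in normal form, $1\le i_j\le j+1$). Then $$\partial_{u}\mathfrak{S}_{w_0^n}=\sum_{J_{n-1},\ldots,J_2,J_1}X^{u}_{J_{n-1}}\,X^{u(J_{n-1})}_{J_{n-2}}\cdots X^{u(J_{n-1},J_{n-2},\ldots,J_2)}_{J_1},$$ where the summation is over all sequences $J_{n-1},\ldots,J_1$ such that $u(J_{n-1},\ldots,J_l)$ is defined for every $1\le l\le n-1$.
   Context: For integers $i,j$, $[i,j]=\{i,i+1,\ldots,j\}$ if $i\le j$ and $\emptyset$ otherwise. Symmetric group and normal forms. $S_n$ is generated by $s_1,\ldots,s_{n-1}$, $s_i$ being the adjacent transposition $(i,i+1)$. For $j\le i$ let $s_{i,j}$ be the word $s_is_{i-1}\cdots s_j$, and let $s_{i,j}=1$ (empty word) if $j>i$; in particular $s_{0,i}=1$ for $i\ge 1$. Every element of $S_n$ is represented by exactly one word of the form $s_{1,i_1}s_{2,i_2}\cdots s_{n-1,i_{n-1}}$ with $1\le i_j\le j+1$, called its normal form; elements of $S_n$ are always written in normal form ($S_1$ consists of $1$ only). For a word $w$ in the $s_i$, $[w]$ denotes the normal form of the element it represents. A word is reduced if no shorter word represents the same element. Divided differences. $s_if$ is the result of interchanging $x_i$ and $x_{i+1}$ in the polynomial $f$, and $\partial_i(f)=\frac{f-s_if}{x_i-x_{i+1}}$; $\partial_i^1=\partial_i$, $\partial_i^0=\mathrm{id}$. For a word $u=s_{a_1}\cdots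 s_{a_p}$, $\partial_u=\partial_{a_1}\cdots\partial_{a_p}$ (and $\partial_1=\mathrm{id}$ for the empty word). $w_0^n=s_{1,1}s_{2,1}\cdots s_{n-1,1}$ and $\mathfrak{S}_{w_0^n}=x_1^{n-1}x_2^{n-2}\cdots x_{n-2}^2x_{n-1}$. (So $\partial_u\mathfrak{S}_{w_0^n}$ is the Schubert polynomial of $w_0^nu^{-1}$.) Right-normed notation. For linear operators $\delta_1,\ldots,\delta_{N-1}$ on polynomials, $[\delta_1x_1\delta_2x_2\cdots\delta_{N-1}x_{N-1}]_R=\delta_1(x_1(\delta_2(x_2(\cdots(\delta_{N-2}(x_{N-2}(\delta_{N-1}x_{N-1})))\cdots))))$. One step. Let $N\ge 2$, $v=s_{1,i_1}\cdots s_{N-1,i_{N-1}}\in S_N$ in normal form, and let $J_{N-1}$ be any subset of $\{l\in[1,N-2]\mid i_l\le l\}$. For $q\in[1,N-1]$ put $\delta^v_{J_{N-1},q}=s_q$ (the operator interchanging $x_q,x_{q+1}$) and $r_q=q$ if $q\in J_{N-1}$; if $q\notin J_{N-1}$ put $r_q=q-1$, and $\delta^v_{J_{N-1},q}=\partial_q$ if $i_q\le q$, $\delta^v_{J_{N-1},q}=\mathrm{id}$ if $i_q=q+1$. Define $$X^v_{J_{N-1}}=[\delta^v_{J_{N-1},1}x_1\,\delta^v_{J_{N-1},2}x_2\cdots\delta^v_{J_{N-1},N-1}x_{N-1}]_R .$$ If the word $s_{r_1,i_1}s_{r_2,i_2}\cdots s_{r_{N-1},i_{N-1}}$ is reduced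 and $X^v_{J_{N-1}}\ne 0$, define $v(J_{N-1})=[s_{r_1,i_1}\cdots s_{r_{N-1},i_{N-1}}]\in S_{N-1}$; otherwise $v(J_{N-1})$ is undefined. Iteration. Given $u\in S_n$, $u(J_{n-1})\in S_{n-1}$ is given by the one-step definition with $N=n$. Inductively, if $u(J_{n-1},\ldots,J_{n-l})\in S_{n-l}$ is defined, then $J_{n-l-1}$ ranges over the subsets allowed by the one-step definition for $v=u(J_{n-1},\ldots,J_{n-l})$ and $N=n-l$, and $u(J_{n-1},\ldots,J_{n-l},J_{n-l-1})=v(J_{n-l-1})$, with $X^{u(J_{n-1},\ldots,J_{n-l})}_{J_{n-l-1}}=X^v_{J_{n-l-1}}$; if $u(J_{n-1},\ldots,J_{n-l})$ is undefined, then so is $u(J_{n-1},\ldots,J_{n-l-1})$. (The range of each $J_k$ thus depends on the earlier choices.) *)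

theory Defs
  imports "HOL-Library.Poly_Mapping" "HOL-Combinatorics.Transposition"
begin

text \<open>
  Polynomials over the integers in the variables \<open>Var 1, Var 2, \<dots>\<close>: a monomial is its finitely
  supported exponent function, a polynomial the finitely supported function of its coefficients.
  The index \<open>0\<close> is never used.
\<close>

type_synonym pol = "(nat \<Rightarrow>\<^sub>0 nat) \<Rightarrow>\<^sub>0 int"

definition Var :: "nat \<Rightarrow> pol" where
  "Var i = Poly_Mapping.single (Poly_Mapping.single i 1) 1"

text \<open>The involution \<open>m \<mapsto> m \<circ> transpose i (i + 1)\<close> on monomials, applied to all monomials
  of a polynomial.\<close>

definition swap_vars :: "nat \<Rightarrow> pol \<Rightarrow> pol" where
  "swap_vars i f = Poly_Mapping.map_key (Poly_Mapping.map_key (transpose i (Suc i))) f"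

definition divdiff :: "nat \<Rightarrow> pol \<Rightarrow> pol" where
  "divdiff i f = (THE g. (Var i - Var (Suc i)) * g = f - swap_vars i f)"

lemma lookup_map_key_transpose:
  "Poly_Mapping.lookup (Poly_Mapping.map_key (transpose a b) m) k
    = Poly_Mapping.lookup m (transpose a b k)"
  by (simp add: Poly_Mapping.map_key.rep_eq)

lemma map_key_transpose_twice:
  "Poly_Mapping.map_key (transpose a b) (Poly_Mapping.map_key (transpose a b) m) = m"
  by (rule poly_mapping_eqI) (simp add: lookup_map_key_transpose)

lemma inj_map_key_transpose: "inj (Poly_Mapping.map_key (transpose a b))"
  by (metis injI map_key_transpose_twice)

lemma swap_vars_add: "swap_vars i (f + g) = swap_vars i f + swap_vars i g"
  by (simp add: swap_vars_def Poly_Mapping.map_key_plus inj_map_key_transpose)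

lemma swap_vars_single:
  "swap_vars i (Poly_Mapping.single m c)
    = Poly_Mapping.single (Poly_Mapping.map_key (transpose i (Suc i)) m) c"
  unfolding swap_vars_def
  by (metis Poly_Mapping.map_key_single inj_map_key_transpose map_key_transpose_twice)

lemma Var_power: "Var i ^ p = Poly_Mapping.single (Poly_Mapping.single i p) 1"
  by (induction p) (simp_all add: Var_def Poly_Mapping.mult_single flip: Poly_Mapping.single_add)

lemma diff_dvd_exchange:
  fixes a b :: "'a :: comm_ring_1"
  shows "a - b dvd a ^ p * b ^ q - b ^ p * a ^ q"
proof -
  have *: "a - b dvd a ^ k - b ^ k" for k
    by (simp add: power_diff_sumr2)
  have "a ^ p * b ^ q - b ^ p * a ^ q = (a ^ p - b ^ p) * b ^ q - b ^ p * (a ^ q - b ^ q)"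
    by (simp add: algebra_simps)
  then show ?thesis using * by (metis dvd_diff dvd_mult dvd_mult2)
qed

lemma divdiff_exists: "Var i - Var (Suc i) dvd f - swap_vars i f"
proof (induction f rule: Poly_Mapping.update_induct)
  case const
  show ?case by (simp add: swap_vars_def Poly_Mapping.map_key_zero inj_map_key_transpose)
next
  case (update f m c)
  let ?p = "Poly_Mapping.lookup m i" and ?q = "Poly_Mapping.lookup m (Suc i)"
  let ?m' = "Poly_Mapping.map_key (transpose i (Suc i)) m"
  define m0 where "m0 = m - Poly_Mapping.single i ?p - Poly_Mapping.single (Suc i) ?q"
  have m: "m = m0 + Poly_Mapping.single i ?p + Poly_Mapping.single (Suc i) ?q"
    by (rule poly_mapping_eqI)
      (auto simp: m0_def lookup_add lookup_minus lookup_single when_def)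
  have m': "?m' = m0 + Poly_Mapping.single (Suc i) ?p + Poly_Mapping.single i ?q"
    by (rule poly_mapping_eqI)
      (auto simp: m0_def lookup_add lookup_minus lookup_single when_def
        lookup_map_key_transpose transpose_def)
  have 1: "Poly_Mapping.single m c = Poly_Mapping.single m0 c * (Var i ^ ?p * Var (Suc i) ^ ?q)"
    by (subst m) (simp add: Var_power Poly_Mapping.mult_single add.assoc)
  have 2: "Poly_Mapping.single ?m' c
      = Poly_Mapping.single m0 c * (Var (Suc i) ^ ?p * Var i ^ ?q)"
    by (subst m') (simp add: Var_power Poly_Mapping.mult_single add.assoc)
  have 3: "Var i - Var (Suc i) dvd Poly_Mapping.single m c - Poly_Mapping.single ?m' c"
    unfolding 1 2 by (metis diff_dvd_exchange dvd_mult right_diff_distrib)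
  have "Poly_Mapping.update m c f = f + Poly_Mapping.single m c"
    using update(1) by (auto intro!: poly_mapping_eqI
        simp: lookup_add lookup_single lookup_update when_def in_keys_iff)
  then have "Poly_Mapping.update m c f - swap_vars i (Poly_Mapping.update m c f)
      = (f - swap_vars i f) + (Poly_Mapping.single m c - Poly_Mapping.single ?m' c)"
    by (simp add: swap_vars_add swap_vars_single)
  with update 3 show ?case by (metis dvd_add)
qed

lemma Var_diff_nonzero: "Var i - Var (Suc i) \<noteq> 0"
proof
  assume "Var i - Var (Suc i) = 0"
  then have "Poly_Mapping.lookup (Var i) (Poly_Mapping.single i 1)
      = Poly_Mapping.lookup (Var (Suc i)) (Poly_Mapping.single i 1)" by simp
  moreover have "Poly_Mapping.single (Suc i) (1::nat) \<noteq> Poly_Mapping.single i 1"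
    by (metis lookup_single_eq lookup_single_not_eq n_not_Suc_n zero_neq_one)
  ultimately show False by (simp add: Var_def lookup_single when_def)
qed

lemma divdiff_eq: "(Var i - Var (Suc i)) * divdiff i f = f - swap_vars i f"
proof -
  obtain g where g: "(Var i - Var (Suc i)) * g = f - swap_vars i f"
    using divdiff_exists[of i f] by (metis dvdE)
  have "\<exists>!g. (Var i - Var (Suc i)) * g = f - swap_vars i f"
    using g Var_diff_nonzero[of i] by (metis mult_left_cancel)
  then show ?thesis unfolding divdiff_def by (rule theI')
qed

definition divdiff_word :: "nat list \<Rightarrow> pol \<Rightarrow> pol" where
  "divdiff_word w = foldr (\<lambda>a D. divdiff a \<circ> D) w id"

definition schubert_w0 :: "nat \<Rightarrow> pol" where
  "schubert_w0 n = (\<Prod>k\<in>{1..n-1}. Var k ^ (n - k))"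

text \<open>A word in the \<open>s\<^sub>i\<close> is the list of its subscripts.\<close>

definition word_perm :: "nat list \<Rightarrow> nat \<Rightarrow> nat" where
  "word_perm w = foldr (\<lambda>a p. transpose a (Suc a) \<circ> p) w id"

definition reduced :: "nat \<Rightarrow> nat list \<Rightarrow> bool" where
  "reduced n w \<longleftrightarrow>
    \<not> (\<exists>w'. set w' \<subseteq> {1..<n} \<and> word_perm w' = word_perm w \<and> length w' < length w)"

text \<open>The word \<open>s\<^sub>i s\<^sub>i\<^sub>-\<^sub>1 \<dots> s\<^sub>j\<close>, which is empty if \<open>j > i\<close>.\<close>

definition seg :: "nat \<Rightarrow> nat \<Rightarrow> nat list" where
  "seg i j = rev [j..<Suc i]"

text \<open>
  The normal form \<open>s\<^sub>1\<^sub>,\<^sub>i\<^sub>1 s\<^sub>2\<^sub>,\<^sub>i\<^sub>2 \<dots>\<close> is given by the list \<open>v\<close> of its second indices; lists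
  count from \<open>0\<close>, so the \<open>q\<close>-th index is \<open>ix v q = v ! (q - 1)\<close>.
\<close>

abbreviation ix :: "nat list \<Rightarrow> nat \<Rightarrow> nat" where
  "ix v q \<equiv> v ! (q - 1)"

definition normal_form :: "nat \<Rightarrow> nat list \<Rightarrow> bool" where
  "normal_form n v \<longleftrightarrow> length v = n - 1 \<and> (\<forall>j\<in>{1..n-1}. 1 \<le> ix v j \<and> ix v j \<le> j + 1)"

definition nf_word :: "nat \<Rightarrow> nat list \<Rightarrow> nat list" where
  "nf_word n v = concat (map (\<lambda>j. seg j (ix v j)) [1..<n])"

definition normalize_word :: "nat \<Rightarrow> nat list \<Rightarrow> nat list" where
  "normalize_word n w = (THE v. normal_form n v \<and> word_perm (nf_word n v) = word_perm w)"

definition allowed :: "nat \<Rightarrow> nat list \<Rightarrow> nat set set" where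
  "allowed N v = Pow {l \<in> {1..N-2}. ix v l \<le> l}"

definition delta :: "nat list \<Rightarrow> nat set \<Rightarrow> nat \<Rightarrow> pol \<Rightarrow> pol" where
  "delta v J q =
    (if q \<in> J then swap_vars q else if ix v q \<le> q then divdiff q else id)"

definition rr :: "nat set \<Rightarrow> nat \<Rightarrow> nat" where
  "rr J q = (if q \<in> J then q else q - 1)"

definition X_pol :: "nat \<Rightarrow> nat list \<Rightarrow> nat set \<Rightarrow> pol" where
  "X_pol N v J = foldr (\<lambda>q p. delta v J q (Var q * p)) [1..<N] 1"

definition step_word :: "nat \<Rightarrow> nat list \<Rightarrow> nat set \<Rightarrow> nat list" where
  "step_word N v J = concat (map (\<lambda>q. seg (rr J q) (ix v q)) [1..<N])"

text \<open>The element \<open>v(J)\<close>, where \<open>None\<close> means undefined; subsets outside the range of \<open>J\<close>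
  also give \<open>None\<close>.\<close>

definition step :: "nat \<Rightarrow> nat list \<Rightarrow> nat set \<Rightarrow> nat list option" where
  "step N v J =
    (if J \<in> allowed N v \<and> reduced N (step_word N v J) \<and> X_pol N v J \<noteq> 0
     then Some (normalize_word (N - 1) (step_word N v J)) else None)"

text \<open>A sequence \<open>J\<^sub>n\<^sub>-\<^sub>1, J\<^sub>n\<^sub>-\<^sub>2, \<dots>\<close> is a list starting with \<open>J\<^sub>n\<^sub>-\<^sub>1\<close>.\<close>

fun iter :: "nat \<Rightarrow> nat list \<Rightarrow> nat set list \<Rightarrow> nat list option" where
  "iter n u [] = Some u"
| "iter n u (J # Js) = (case step n u J of None \<Rightarrow> None | Some v \<Rightarrow> iter (n - 1) v Js)"

lemma iter_snoc:
  "iter n u (Js @ [J]) =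
    (case iter n u Js of None \<Rightarrow> None | Some v \<Rightarrow> step (n - length Js) v J)"
  by (induction n u Js rule: iter.induct) (auto split: option.splits)

text \<open>As \<open>take (n - l) Js\<close> is \<open>J\<^sub>n\<^sub>-\<^sub>1, \<dots>, J\<^sub>l\<close>, the condition says that
  \<open>u(J\<^sub>n\<^sub>-\<^sub>1, \<dots>, J\<^sub>l)\<close> is defined for all \<open>l\<close>.\<close>

definition J_seqs :: "nat \<Rightarrow> nat list \<Rightarrow> nat set list set" where
  "J_seqs n u =
    {Js. length Js = n - 1 \<and> (\<forall>l\<in>{1..n-1}. iter n u (take (n - l) Js) \<noteq> None)}"

text \<open>The factor for \<open>k\<close> is the one with lower index \<open>J\<^sub>n\<^sub>-\<^sub>1\<^sub>-\<^sub>k\<close>; its upper index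
  \<open>u(J\<^sub>n\<^sub>-\<^sub>1, \<dots>, J\<^sub>n\<^sub>-\<^sub>k)\<close> lies in \<open>S\<^sub>n\<^sub>-\<^sub>k\<close>.\<close>

definition X_prod :: "nat \<Rightarrow> nat list \<Rightarrow> nat set list \<Rightarrow> pol" where
  "X_prod n u Js = (\<Prod>k<n-1. X_pol (n - k) (the (iter n u (take k Js))) (Js ! k))"

lemma finite_J_seqs: "finite (J_seqs n u)"
proof -
  have *: "iter m v Js \<noteq> None \<Longrightarrow> m \<le> n \<Longrightarrow> set Js \<subseteq> Pow {1..n}" for m v Js
  proof (induction m v Js rule: iter.induct)
    case (2 m v J Js)
    then have "J \<subseteq> {1..n}"
      by (fastforce simp: step_def allowed_def split: option.splits if_splits)
    with 2 show ?case by (auto split: option.splits)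
  qed simp
  have "J_seqs n u \<subseteq> {Js. set Js \<subseteq> Pow {1..n} \<and> length Js = n - 1}"
  proof
    fix Js assume Js: "Js \<in> J_seqs n u"
    show "Js \<in> {Js. set Js \<subseteq> Pow {1..n} \<and> length Js = n - 1}"
    proof (cases "n \<ge> 2")
      case True
      then have "iter n u (take (n - 1) Js) \<noteq> None" "length Js = n - 1"
        using Js unfolding J_seqs_def by fastforce+
      moreover from this(2) have "take (n - 1) Js = Js" by simp
      ultimately show ?thesis using *[of n u Js] by simp
    qed (use Js in \<open>auto simp: J_seqs_def\<close>)
  qed
  then show ?thesis
    by (rule finite_subset) (rule finite_lists_length_eq, simp)
qed

end

theory Submission
  imports Defs
begin

text \<open>
  Since the staircase monomial of \<open>S\<^sub>n\<close> is \<open>x\<^sub>1 \<dots> x\<^sub>n\<^sub>-\<^sub>1\<close> times the one for \<open>S\<^sub>n\<^sub>-\<^sub>1\<close>, the divided differences of the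
  normal form of \<open>u\<close> can be moved past \<open>x\<^sub>1 \<dots> x\<^sub>n\<^sub>-\<^sub>1\<close> by the Leibniz rule. This gives the sum over
  \<open>J\<close> of \<open>X\<^sub>J\<close> times the divided differences of the word of \<open>u(J)\<close> applied to the
  smaller monomial. Divided differences satisfy the nil-Coxeter relations, and these suffice to
  rewrite every word to a normal form. So a nonreduced word acts as \<open>0\<close> and a reduced one acts like
  its normal form, and the theorem follows by induction on \<open>n\<close>.
\<close>

section \<open>Divided differences\<close>

lemma lookup_swap_vars:
  "Poly_Mapping.lookup (swap_vars i f) m
    = Poly_Mapping.lookup f (Poly_Mapping.map_key (transpose i (Suc i)) m)"
  by (simp add: swap_vars_def Poly_Mapping.map_key.rep_eq inj_map_key_transpose)

lemma swap_vars_swap_vars [simp]: "swap_vars i (swap_vars i f) = f"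
  by (rule poly_mapping_eqI) (simp add: lookup_swap_vars map_key_transpose_twice)

lemma swap_vars_0 [simp]: "swap_vars i 0 = 0"
  by (rule poly_mapping_eqI) (simp add: lookup_swap_vars)

lemma swap_vars_diff: "swap_vars i (f - g) = swap_vars i f - swap_vars i g"
  by (rule poly_mapping_eqI) (simp add: lookup_swap_vars lookup_minus)

lemma swap_vars_sum: "swap_vars i (sum g S) = (\<Sum>x\<in>S. swap_vars i (g x))"
  by (induction S rule: infinite_finite_induct) (simp_all add: swap_vars_add)

text \<open>Suited to properties that are additive in the polynomial: the added term need not be
  new.\<close>

lemma pol_induct [case_names zero add_single]:
  fixes f :: pol
  assumes "P 0" and "\<And>f m c. P f \<Longrightarrow> P (f + Poly_Mapping.single m c)"
  shows "P f"
proof (induction f rule: Poly_Mapping.update_induct)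
  case const
  show ?case by (rule assms(1))
next
  case (update f m c)
  have "Poly_Mapping.update m c f = f + Poly_Mapping.single m c"
    using update(1) by (auto intro!: poly_mapping_eqI
        simp: lookup_add lookup_single lookup_update when_def in_keys_iff)
  with assms(2)[OF update(3)] show ?case by simp
qed

text \<open>Additivity in both arguments reduces this to single terms, where the renaming of
  variables is additive on exponents.\<close>

lemma swap_vars_mult: "swap_vars i (f * g) = swap_vars i f * swap_vars i g"
proof (induction f rule: pol_induct)
  case (add_single f m c)
  have "swap_vars i (Poly_Mapping.single m c * g)
      = swap_vars i (Poly_Mapping.single m c) * swap_vars i g"
    by (induction g rule: pol_induct)
      (simp_all add: distrib_left swap_vars_add swap_vars_single Poly_Mapping.mult_single
        Poly_Mapping.map_key_plus)
  with add_single show ?case by (simp add: distrib_right swap_vars_add)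
qed simp

lemma swap_vars_Var: "swap_vars i (Var k) = Var (transpose i (Suc i) k)"
proof -
  have "Poly_Mapping.map_key (transpose i (Suc i)) (Poly_Mapping.single k (1::nat))
      = Poly_Mapping.single (transpose i (Suc i) k) 1"
    by (rule poly_mapping_eqI)
      (auto simp: lookup_map_key_transpose lookup_single when_def transpose_def)
  then show ?thesis by (simp add: Var_def swap_vars_single)
qed

lemma swap_vars_1 [simp]: "swap_vars i 1 = 1"
  by (simp flip: Poly_Mapping.single_one add: swap_vars_single)

lemma swap_vars_commute:
  assumes "Suc i < j \<or> Suc j < i"
  shows "swap_vars i (swap_vars j f) = swap_vars j (swap_vars i f)"
proof -
  have "Poly_Mapping.map_key (transpose j (Suc j)) (Poly_Mapping.map_key (transpose i (Suc i)) m)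
      = Poly_Mapping.map_key (transpose i (Suc i)) (Poly_Mapping.map_key (transpose j (Suc j)) m)"
    for m :: "nat \<Rightarrow>\<^sub>0 nat"
    using assms by (intro poly_mapping_eqI) (auto simp: lookup_map_key_transpose transpose_def)
  then show ?thesis by (intro poly_mapping_eqI) (simp add: lookup_swap_vars)
qed

lemma swap_vars_braid:
  "swap_vars i (swap_vars (Suc i) (swap_vars i f))
    = swap_vars (Suc i) (swap_vars i (swap_vars (Suc i) f))"
proof -
  let ?s = "Poly_Mapping.map_key (transpose i (Suc i))"
  let ?t = "Poly_Mapping.map_key (transpose (Suc i) (Suc (Suc i)))"
  have "?s (?t (?s m)) = ?t (?s (?t m))" for m :: "nat \<Rightarrow>\<^sub>0 nat"
    by (intro poly_mapping_eqI) (auto simp: lookup_map_key_transpose transpose_def)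
  then show ?thesis by (intro poly_mapping_eqI) (simp add: lookup_swap_vars)
qed

section \<open>Leibniz rule and nil-Coxeter relations for divided differences\<close>

lemma divdiff_unique: "(Var i - Var (Suc i)) * g = f - swap_vars i f \<Longrightarrow> divdiff i f = g"
  using divdiff_eq[of i f] Var_diff_nonzero[of i] by (metis mult_left_cancel)

lemma divdiff_add: "divdiff i (f + g) = divdiff i f + divdiff i g"
  by (rule divdiff_unique) (simp add: distrib_left divdiff_eq swap_vars_add)

lemma divdiff_diff: "divdiff i (f - g) = divdiff i f - divdiff i g"
  by (rule divdiff_unique) (simp add: right_diff_distrib divdiff_eq swap_vars_diff)

lemma divdiff_invariant: "swap_vars i f = f \<Longrightarrow> divdiff i f = 0"
  by (rule divdiff_unique) simp

lemma divdiff_0 [simp]: "divdiff i 0 = 0"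
  by (rule divdiff_invariant) simp

lemma divdiff_sum: "divdiff i (sum g S) = (\<Sum>x\<in>S. divdiff i (g x))"
  by (induction S rule: infinite_finite_induct) (simp_all add: divdiff_add)

text \<open>From \<open>f g - s f s g = (f - s f) g + s f (g - s g)\<close>. The swap falls on the
  first factor, which is where \<open>delta\<close> needs it.\<close>

lemma divdiff_leibniz: "divdiff i (f * g) = divdiff i f * g + swap_vars i f * divdiff i g"
proof (rule divdiff_unique)
  have "(Var i - Var (Suc i)) * (divdiff i f * g + swap_vars i f * divdiff i g)
      = (Var i - Var (Suc i)) * divdiff i f * g
        + swap_vars i f * ((Var i - Var (Suc i)) * divdiff i g)"
    by (simp add: algebra_simps)
  also have "\<dots> = f * g - swap_vars i (f * g)"
    unfolding divdiff_eq by (simp add: algebra_simps swap_vars_mult)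
  finally show "(Var i - Var (Suc i)) * (divdiff i f * g + swap_vars i f * divdiff i g)
      = f * g - swap_vars i (f * g)" .
qed

lemma divdiff_mult_invariant: "swap_vars i f = f \<Longrightarrow> divdiff i (f * g) = f * divdiff i g"
  by (simp add: divdiff_leibniz divdiff_invariant)

lemma divdiff_Var: "divdiff i (Var i) = 1"
  by (rule divdiff_unique) (simp add: swap_vars_Var)

text \<open>Numerator and denominator both change sign under the swap.\<close>

lemma swap_vars_divdiff: "swap_vars i (divdiff i f) = divdiff i f"
proof -
  have "swap_vars i ((Var i - Var (Suc i)) * divdiff i f) = swap_vars i f - f"
    by (simp add: divdiff_eq swap_vars_diff)
  then have "(Var i - Var (Suc i)) * swap_vars i (divdiff i f) = f - swap_vars i f"
    by (simp add: swap_vars_mult swap_vars_diff swap_vars_Var algebra_simps)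
  then show ?thesis by (metis divdiff_unique)
qed

lemma divdiff_divdiff [simp]: "divdiff i (divdiff i f) = 0"
  by (rule divdiff_invariant) (rule swap_vars_divdiff)

lemma swap_vars_divdiff_commute:
  assumes "Suc i < j \<or> Suc j < i"
  shows "swap_vars j (divdiff i f) = divdiff i (swap_vars j f)"
proof (rule divdiff_unique[symmetric])
  have "swap_vars j (Var i - Var (Suc i)) = Var i - Var (Suc i)"
    using assms by (auto simp: swap_vars_diff swap_vars_Var transpose_def)
  then have "(Var i - Var (Suc i)) * swap_vars j (divdiff i f)
      = swap_vars j ((Var i - Var (Suc i)) * divdiff i f)"
    by (simp only: swap_vars_mult)
  then show "(Var i - Var (Suc i)) * swap_vars j (divdiff i f)
      = swap_vars j f - swap_vars i (swap_vars j f)"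
    by (simp add: divdiff_eq swap_vars_diff swap_vars_commute[OF assms])
qed

text \<open>The swap at \<open>j\<close> fixes \<open>Var i - Var (Suc i)\<close>, so
  \<open>divdiff j\<close> can be applied to the defining equation of
  \<open>divdiff i\<close>.\<close>

lemma divdiff_commute:
  assumes "Suc i < j \<or> Suc j < i"
  shows "divdiff i (divdiff j f) = divdiff j (divdiff i f)"
proof (rule divdiff_unique)
  have "swap_vars j (Var i - Var (Suc i)) = Var i - Var (Suc i)"
    using assms by (auto simp: swap_vars_diff swap_vars_Var transpose_def)
  then have "(Var i - Var (Suc i)) * divdiff j (divdiff i f) = divdiff j (f - swap_vars i f)"
    by (metis divdiff_mult_invariant divdiff_eq)
  also have "\<dots> = divdiff j f - swap_vars i (divdiff j f)"
    using assms by (metis divdiff_diff swap_vars_divdiff_commute)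
  finally show "(Var i - Var (Suc i)) * divdiff j (divdiff i f)
      = divdiff j f - swap_vars i (divdiff j f)" .
qed

text \<open>Both sides become the antisymmetrisation over $S_3$ when multiplied by the
  Vandermonde product.\<close>

lemma divdiff_braid:
  "divdiff i (divdiff (Suc i) (divdiff i f))
    = divdiff (Suc i) (divdiff i (divdiff (Suc i) f))"
proof -
  let ?j = "Suc i"
  define a b c where "a = Var i" and "b = Var ?j" and "c = Var (Suc ?j)"
  define s t where "s = swap_vars i" and "t = swap_vars ?j"
  note defs = a_def b_def c_def s_def t_def
  have var: "s a = b" "s b = a" "s c = c" "t a = a" "t b = c" "t c = b"
    by (simp_all add: defs swap_vars_Var transpose_def)
  have hom: "s (f * g) = s f * s g" "s (f - g) = s f - s g"
      "t (f * g) = t f * t g" "t (f - g) = t f - t g" for f g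
    by (simp_all add: defs swap_vars_mult swap_vars_diff)
  have di: "(a - b) * divdiff i f = f - s f" and dj: "(b - c) * divdiff ?j f = f - t f" for f
    using divdiff_eq[of i f] divdiff_eq[of ?j f] by (simp_all add: defs)
  have inv: "s (s f) = f" "t (t f) = f" "s (divdiff i f) = divdiff i f"
      "t (divdiff ?j f) = divdiff ?j f" for f
    by (simp_all add: defs swap_vars_divdiff)
  have left: "(a - b) * (b - c) * (a - c) * divdiff i (divdiff ?j (divdiff i f))
      = f - s f - t f + t (s f) + s (t f) - s (t (s f))"
  proof -
    define g where "g = divdiff i f"
    have 1: "(b - c) * divdiff ?j g = g - t g" by (rule dj)
    have "s ((b - c) * divdiff ?j g) = s (g - t g)" by (simp add: dj)
    then have 2: "(a - c) * s (divdiff ?j g) = g - s (t g)" by (simp add: hom var inv g_def)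
    have 3: "(a - b) * g = f - s f" by (simp add: g_def di)
    have "t ((a - b) * g) = t (f - s f)" by (simp add: 3)
    then have 4: "(a - c) * t g = t f - t (s f)" by (simp add: hom var)
    have "s ((a - c) * t g) = s (t f - t (s f))" by (simp add: 4)
    then have 5: "(b - c) * s (t g) = s (t f) - s (t (s f))" by (simp add: hom var)
    have "(a - b) * (b - c) * (a - c) * divdiff i (divdiff ?j g)
        = (b - c) * (a - c) * ((a - b) * divdiff i (divdiff ?j g))" by (simp add: mult_ac)
    also have "\<dots> = (a - c) * ((b - c) * divdiff ?j g) - (b - c) * ((a - c) * s (divdiff ?j g))"
      unfolding di by (simp add: algebra_simps)
    also have "\<dots> = (a - b) * g - (a - c) * t g + (b - c) * s (t g)"
      unfolding 1 2 by (simp add: algebra_simps)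
    finally show ?thesis unfolding 3 4 5 by (simp add: g_def)
  qed
  have right: "(a - b) * (b - c) * (a - c) * divdiff ?j (divdiff i (divdiff ?j f))
      = f - s f - t f + t (s f) + s (t f) - t (s (t f))"
  proof -
    define g where "g = divdiff ?j f"
    have 1: "(a - b) * divdiff i g = g - s g" by (rule di)
    have "t ((a - b) * divdiff i g) = t (g - s g)" by (simp add: di)
    then have 2: "(a - c) * t (divdiff i g) = g - t (s g)" by (simp add: hom var inv g_def)
    have 3: "(b - c) * g = f - t f" by (simp add: g_def dj)
    have "s ((b - c) * g) = s (f - t f)" by (simp add: 3)
    then have 4: "(a - c) * s g = s f - s (t f)" by (simp add: hom var)
    have "t ((a - c) * s g) = t (s f - s (t f))" by (simp add: 4)
    then have 5: "(a - b) * t (s g) = t (s f) - t (s (t f))" by (simp add: hom var)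
    have "(a - b) * (b - c) * (a - c) * divdiff ?j (divdiff i g)
        = (a - b) * (a - c) * ((b - c) * divdiff ?j (divdiff i g))" by (simp add: mult_ac)
    also have "\<dots> = (a - c) * ((a - b) * divdiff i g) - (a - b) * ((a - c) * t (divdiff i g))"
      unfolding dj by (simp add: algebra_simps)
    also have "\<dots> = (b - c) * g - (a - c) * s g + (a - b) * t (s g)"
      unfolding 1 2 by (simp add: algebra_simps)
    finally show ?thesis unfolding 3 4 5 by (simp add: g_def)
  qed
  have "a - b \<noteq> 0" "b - c \<noteq> 0" by (simp_all only: defs Var_diff_nonzero not_False_eq_True)
  \<comment> \<open>The involution \<open>t\<close> carries \<open>a - b\<close> to
    \<open>a - c\<close>.\<close>
  moreover from this(1) have "a - c \<noteq> 0"
    using var hom by (metis inv(2) right_minus_eq)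
  moreover have "s (t (s f)) = t (s (t f))" by (simp add: defs swap_vars_braid)
  ultimately show ?thesis using left right
    by (metis (no_types, lifting) mult_left_cancel no_zero_divisors)
qed

section \<open>Words\<close>

lemma divdiff_word_Nil [simp]: "divdiff_word [] f = f"
  by (simp add: divdiff_word_def)

lemma divdiff_word_Cons [simp]: "divdiff_word (a # w) f = divdiff a (divdiff_word w f)"
  by (simp add: divdiff_word_def)

lemma divdiff_word_append [simp]:
  "divdiff_word (w @ w') f = divdiff_word w (divdiff_word w' f)"
  by (induction w) simp_all

lemma divdiff_word_0 [simp]: "divdiff_word w 0 = 0"
  by (induction w) simp_all

lemma divdiff_word_sum: "divdiff_word w (sum g S) = (\<Sum>x\<in>S. divdiff_word w (g x))"
  by (induction w) (simp_all add: divdiff_sum)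

lemma divdiff_word_mult_invariant:
  "(\<And>k. k \<in> set w \<Longrightarrow> swap_vars k f = f) \<Longrightarrow> divdiff_word w (f * g) = f * divdiff_word w g"
  by (induction w) (simp_all add: divdiff_mult_invariant)

lemma word_perm_Nil [simp]: "word_perm [] x = x"
  by (simp add: word_perm_def)

lemma word_perm_Cons [simp]: "word_perm (a # w) x = transpose a (Suc a) (word_perm w x)"
  by (simp add: word_perm_def)

lemma word_perm_append [simp]: "word_perm (w @ w') x = word_perm w (word_perm w' x)"
  by (induction w) simp_all

lemma word_perm_fixes: "(\<And>k. k \<in> set w \<Longrightarrow> Suc k < x) \<Longrightarrow> word_perm w x = x"
proof (induction w)
  case (Cons a w)
  then have "Suc a < x" "word_perm w x = x" by simp_all
  then show ?case by (simp add: transpose_def)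
qed simp

lemma inj_word_perm: "inj (word_perm w)"
  by (induction w) (auto simp: inj_def transpose_eq_iff)

section \<open>Descending segments\<close>

lemma set_seg: "set (seg i j) = {j..i}"
  by (auto simp: seg_def)

lemma seg_empty [simp]: "i < j \<Longrightarrow> seg i j = []"
  by (simp add: seg_def)

lemma seg_Cons: "j \<le> i \<Longrightarrow> 1 \<le> j \<Longrightarrow> seg i j = i # seg (i - 1) j"
  by (simp add: seg_def)

lemma seg_snoc: "j \<le> i \<Longrightarrow> seg i j = seg i (Suc j) @ [j]"
  by (simp add: seg_def upt_rec[of j])

lemma seg_split: "j \<le> Suc k \<Longrightarrow> k \<le> i \<Longrightarrow> seg i j = seg i (Suc k) @ seg k j"
  using upt_add_eq_append[of j "Suc k" "i - k"] by (simp add: seg_def)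

text \<open>Read from the right, the letters move \<open>j\<close> to \<open>j + 1\<close>, then to
  \<open>j + 2\<close>, and finally to \<open>i + 1\<close>.\<close>

lemma word_perm_seg: "j \<le> Suc i \<Longrightarrow> word_perm (seg i j) j = Suc i"
proof (induction "Suc i - j" arbitrary: j)
  case (Suc d)
  then have "word_perm (seg i j) j = word_perm (seg i (Suc j)) (Suc j)"
    by (simp add: seg_snoc)
  also have "\<dots> = Suc i" using Suc by simp
  finally show ?case .
qed simp

text \<open>Rewriting in the nil-Coxeter algebra: either both words represent the same element of it,
  or \<open>w\<close> represents \<open>0\<close> and \<open>w'\<close> is a strictly shorter word for the same permutation.\<close>

definition contracts :: "nat list \<Rightarrow> nat list \<Rightarrow> bool" where
  "contracts w w' \<longleftrightarrow> word_perm w = word_perm w' \<and>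
    (length w' = length w \<and> divdiff_word w = divdiff_word w' \<or>
     length w' < length w \<and> divdiff_word w = (\<lambda>f. 0))"

lemma contracts_refl: "contracts w w"
  by (simp add: contracts_def)

text \<open>Lengths never grow, and one strict drop anywhere in a chain makes the operator of the
  first word \<open>0\<close>.\<close>

lemma contracts_trans [trans]: "contracts w w' \<Longrightarrow> contracts w' w'' \<Longrightarrow> contracts w w''"
  unfolding contracts_def by (metis less_trans)

lemma contracts_append: "contracts w w' \<Longrightarrow> contracts (u @ w @ v) (u @ w' @ v)"
  unfolding contracts_def by (auto simp: fun_eq_iff)

lemma contracts_append_left: "contracts w w' \<Longrightarrow> contracts (u @ w) (u @ w')"
  using contracts_append[where v = "[]"] by simp

lemma contracts_append_right: "contracts w w' \<Longrightarrow> contracts (w @ v) (w' @ v)"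
  using contracts_append[where u = "[]"] by simp

lemma contracts_square: "contracts [k, k] []"
  by (simp add: contracts_def fun_eq_iff)

lemma contracts_commute: "Suc i < j \<or> Suc j < i \<Longrightarrow> contracts [i, j] [j, i]"
  by (auto simp: contracts_def fun_eq_iff divdiff_commute) (auto simp: transpose_def)

lemma contracts_braid: "contracts [Suc i, i, Suc i] [i, Suc i, i]"
  by (auto simp: contracts_def fun_eq_iff divdiff_braid) (auto simp: transpose_def)

lemma contracts_commute_word:
  "(\<And>j. j \<in> set w \<Longrightarrow> Suc k < j \<or> Suc j < k) \<Longrightarrow> contracts (w @ [k]) (k # w)"
proof (induction w)
  case (Cons a w)
  then have "contracts (a # w @ [k]) (a # k # w)"
    using contracts_append_left[of "w @ [k]" "k # w" "[a]"] by simp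
  also have "contracts (a # k # w) (k # a # w)"
    using contracts_append_right[OF contracts_commute[of a k], of w] Cons by auto
  finally show ?case by simp
qed (simp add: contracts_refl)

text \<open>The letter \<open>k\<close> moves left past the letters below \<open>k - 1\<close>, the
  braid relation turns \<open>k, k - 1, k\<close> into \<open>k - 1, k, k - 1\<close>, and the new
  \<open>k - 1\<close> moves left past the letters above \<open>k\<close>.\<close>

lemma contracts_seg_shift:
  assumes "1 \<le> i" "i < k" "k \<le> m"
  shows "contracts (seg m i @ [k]) ((k - 1) # seg m i)"
proof -
  \<comment> \<open>Since \<open>k\<close> is at least 2, nothing is truncated; \<open>?B\<close> is
    empty if \<open>i = k - 1\<close>.\<close>
  define j where "j = k - 2"
  have k: "k = Suc (Suc j)" using assms by (simp add: j_def)
  let ?A = "seg m (Suc k)" and ?B = "seg j i"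
  have "seg m i = ?A @ seg k i" using assms by (intro seg_split) auto
  also have "seg k i = [k, Suc j] @ ?B" using assms k by (simp add: seg_Cons)
  finally have seg: "seg m i = ?A @ [k, Suc j] @ ?B" .
  have "contracts (?B @ [k]) (k # ?B)"
    by (rule contracts_commute_word) (auto simp: k set_seg)
  then have "contracts (seg m i @ [k]) (?A @ [k, Suc j, k] @ ?B)"
    using contracts_append_left[of _ _ "?A @ [k, Suc j]"] by (simp add: seg)
  also have "contracts \<dots> (?A @ [Suc j, k, Suc j] @ ?B)"
    unfolding k by (rule contracts_append) (rule contracts_braid)
  also have "contracts \<dots> ((Suc j # ?A) @ [k, Suc j] @ ?B)"
    using contracts_append_right[OF contracts_commute_word[of ?A "Suc j"], of "[k, Suc j] @ ?B"]
    by (auto simp: set_seg k)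
  finally show ?thesis by (simp add: seg k)
qed

section \<open>Normal forms\<close>

lemma normal_form_1: "normal_form (Suc 0) v \<longleftrightarrow> v = []"
  by (auto simp: normal_form_def)

lemma normal_form_snoc:
  assumes "n \<ge> 1"
  shows "normal_form (Suc n) (v @ [i]) \<longleftrightarrow> normal_form n v \<and> 1 \<le> i \<and> i \<le> Suc n"
proof -
  have "{1..n} = insert n {1..n - 1}" using assms by auto
  moreover have "(v @ [i]) ! (n - 1) = i" if "length v = n - 1"
    using that by (metis nth_append_length)
  moreover have "(v @ [i]) ! (j - 1) = v ! (j - 1)" if "length v = n - 1" "j \<in> {1..n - 1}" for j
    using that by (auto simp: nth_append)
  ultimately show ?thesis using assms unfolding normal_form_def by auto
qed

lemma normal_form_SucE:
  assumes "normal_form (Suc n) v" "n \<ge> 1"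
  obtains v' i where "v = v' @ [i]" "normal_form n v'" "1 \<le> i" "i \<le> Suc n"
proof -
  have "v \<noteq> []" using assms by (auto simp: normal_form_def)
  then have v: "v = butlast v @ [last v]" by simp
  then have "normal_form (Suc n) (butlast v @ [last v])" using assms(1) by simp
  with v that show ?thesis using normal_form_snoc[OF assms(2)] by blast
qed

lemma nf_word_1 [simp]: "nf_word (Suc 0) v = []"
  by (simp add: nf_word_def)

lemma nf_word_snoc:
  assumes "n \<ge> 1" "length v = n - 1"
  shows "nf_word (Suc n) (v @ [i]) = nf_word n v @ seg n i"
proof -
  have "(v @ [i]) ! (n - 1) = i" using assms by (metis nth_append_length)
  moreover have "map (\<lambda>j. seg j (ix (v @ [i]) j)) [1..<n] = map (\<lambda>j. seg j (ix v j)) [1..<n]"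
    using assms by (auto simp: nth_append)
  ultimately show ?thesis using assms(1) by (simp add: nf_word_def del: One_nat_def map_eq_conv)
qed

lemma set_nf_word:
  assumes "normal_form n v"
  shows "set (nf_word n v) \<subseteq> {1..<n}"
proof
  fix k assume "k \<in> set (nf_word n v)"
  then obtain j where j: "j \<in> {1..<n}" "ix v j \<le> k" "k \<le> j"
    by (auto simp: nf_word_def set_seg)
  then have "j \<in> {1..n - 1}" by auto
  then have "1 \<le> ix v j" using assms unfolding normal_form_def by blast
  with j show "k \<in> {1..<n}" by auto
qed

lemma normal_form_length: "normal_form n v \<Longrightarrow> length v = n - 1"
  by (simp add: normal_form_def)

text \<open>The last index is the preimage of \<open>n\<close>.\<close>

lemma normal_form_unique:
  assumes "normal_form n v" "normal_form n w" "word_perm (nf_word n v) = word_perm (nf_word n w)"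
    "n \<ge> 1"
  shows "v = w"
  using assms(4,1-3)
proof (induction n arbitrary: v w rule: dec_induct)
  case base
  then show ?case by (simp add: normal_form_1)
next
  case (step n)
  obtain v' i where v: "v = v' @ [i]" "normal_form n v'" "1 \<le> i" "i \<le> Suc n"
    using step normal_form_SucE by blast
  obtain w' j where w: "w = w' @ [j]" "normal_form n w'" "1 \<le> j" "j \<le> Suc n"
    using step normal_form_SucE by blast
  have nv: "nf_word (Suc n) v = nf_word n v' @ seg n i"
    using v step.hyps by (simp add: nf_word_snoc normal_form_length)
  have nw: "nf_word (Suc n) w = nf_word n w' @ seg n j"
    using w step.hyps by (simp add: nf_word_snoc normal_form_length)
  \<comment> \<open>All letters of the shorter normal form are below \<open>n\<close>, so the last
    segment alone decides the preimage of \<open>Suc n\<close>.\<close>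
  have top: "word_perm (nf_word n x) (Suc n) = Suc n" if "normal_form n x" for x
    using set_nf_word[OF that] by (intro word_perm_fixes) auto
  have "word_perm (nf_word (Suc n) v) i = Suc n"
    using v(2-4) by (simp add: nv word_perm_seg top)
  moreover have "word_perm (nf_word (Suc n) w) j = Suc n"
    using w(2-4) by (simp add: nw word_perm_seg top)
  ultimately have "i = j"
    using step.prems(3) inj_word_perm[of "nf_word (Suc n) w"] by (metis injD)
  have "word_perm (nf_word n v') (word_perm (seg n i) x)
      = word_perm (nf_word n w') (word_perm (seg n i) x)" for x
    using fun_cong[OF step.prems(3), of x] unfolding nv nw \<open>i = j\<close> by simp
  \<comment> \<open>Surjectivity lets the common last segment be cancelled on the right; the
    reversed word supplies the preimage.\<close>
  moreover have "\<exists>x. word_perm (seg n i) x = y" for y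
  proof
    have "word_perm w (word_perm (rev w) y) = y" for w y
      by (induction w arbitrary: y) simp_all
    then show "word_perm (seg n i) (word_perm (rev (seg n i)) y) = y" .
  qed
  ultimately have "word_perm (nf_word n v') = word_perm (nf_word n w')"
    by (metis ext)
  then show ?case using step.IH v w \<open>i = j\<close> by simp
qed

text \<open>Let the last segment end in \<open>i\<close>. The letter \<open>k\<close> passes through
  it unchanged if \<open>k < i - 1\<close> and as \<open>k - 1\<close> if \<open>k > i\<close>; it
  extends the segment if \<open>k = i - 1\<close> and cancels its last letter if
  \<open>k = i\<close>.\<close>

lemma nf_word_append_letter:
  assumes "normal_form n v" "1 \<le> k" "k < n"
  shows "\<exists>v'. normal_form n v' \<and> contracts (nf_word n v @ [k]) (nf_word n v')"
proof -
  have "n \<ge> 1" using assms by simp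
  then show ?thesis using assms
  proof (induction n arbitrary: v k rule: dec_induct)
    case (step n)
    obtain v' i where v: "v = v' @ [i]" "normal_form n v'" "1 \<le> i" "i \<le> Suc n"
      using step normal_form_SucE by blast
    have snoc: "normal_form (Suc n) (x @ [j])"
        "nf_word (Suc n) (x @ [j]) = nf_word n x @ seg n j"
      if "normal_form n x" "1 \<le> j" "j \<le> Suc n" for x j
      using that step.hyps by (simp_all add: normal_form_snoc nf_word_snoc normal_form_length)
    note nv = snoc(2)[OF v(2-4), folded v(1)]
    \<comment> \<open>A letter that has passed the last segment is absorbed by the shorter normal
      form.\<close>
    have pass: ?case
      if l: "contracts (seg n i @ [k]) (l # seg n i)" "1 \<le> l" "l < n" for l
    proof -
      obtain x where x: "normal_form n x" "contracts (nf_word n v' @ [l]) (nf_word n x)"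
        using step.IH[OF v(2) l(2,3)] by blast
      have "contracts (nf_word (Suc n) v @ [k]) (nf_word n v' @ l # seg n i)"
        using contracts_append_left[OF l(1)] by (simp add: nv)
      also have "contracts \<dots> (nf_word n x @ seg n i)"
        using contracts_append_right[OF x(2)] by simp
      finally show ?thesis using snoc[OF x(1) v(3,4)] by auto
    qed
    consider "Suc k < i" | "i = Suc k" | "i = k" | "i < k" by linarith
    then show ?case
    proof cases
      case 1
      then have "contracts (seg n i @ [k]) (k # seg n i)"
        by (intro contracts_commute_word) (auto simp: set_seg)
      then show ?thesis using 1 v step.prems by (intro pass[of k]) auto
    next
      case 2
      then have "nf_word (Suc n) v @ [k] = nf_word (Suc n) (v' @ [k])"
        using step.prems v nv snoc(2)[OF v(2), of k] by (simp add: seg_snoc)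
      then show ?thesis using step.prems snoc(1)[OF v(2), of k] contracts_refl by auto
    next
      \<comment> \<open>The square relation applies here: the word gets shorter and its operator is
        \<open>0\<close>.\<close>
      case 3
      have "contracts (nf_word (Suc n) v @ [k]) (nf_word (Suc n) (v' @ [Suc k]))"
        using 3 step.prems v nv snoc(2)[OF v(2), of "Suc k"]
          contracts_append_left[OF contracts_square[of k], of "nf_word n v' @ seg n (Suc k)"]
        by (simp add: seg_snoc)
      then show ?thesis using step.prems snoc(1)[OF v(2), of "Suc k"] by auto
    next
      case 4
      then have "contracts (seg n i @ [k]) ((k - 1) # seg n i)"
        using v step.prems by (intro contracts_seg_shift) auto
      then show ?thesis using 4 v step.prems by (intro pass[of "k - 1"]) auto
    qed
  qed simp
qed

lemma contracts_to_normal_form: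
  assumes "set w \<subseteq> {1..<n}" "n \<ge> 1"
  shows "\<exists>v. normal_form n v \<and> contracts w (nf_word n v)"
  using assms
proof (induction w rule: rev_induct)
  case Nil
  \<comment> \<open>The normal form of the identity: index \<open>j + 1\<close> at position
    \<open>j\<close> makes every segment empty.\<close>
  define v where "v = map (\<lambda>j. Suc j) [1..<n]"
  have "normal_form n v" "nf_word n v = []"
    by (auto simp: v_def normal_form_def nf_word_def)
  then show ?case using contracts_refl by metis
next
  case (snoc k w)
  then obtain v where v: "normal_form n v" "contracts w (nf_word n v)" by auto
  then have "contracts (w @ [k]) (nf_word n v @ [k])" by (intro contracts_append_right)
  moreover obtain v' where "normal_form n v'" "contracts (nf_word n v @ [k]) (nf_word n v')"
    using nf_word_append_letter[OF v(1), of k] snoc.prems by auto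
  ultimately show ?case using contracts_trans by blast
qed

text \<open>By uniqueness, \<open>w\<close> and a shorter word for the same permutation contract to
  one normal form. So the contraction of \<open>w\<close> drops the length, which forces the
  operator to be \<open>0\<close>.\<close>

lemma divdiff_word_not_reduced:
  assumes "set w \<subseteq> {1..<n}" "n \<ge> 1" "\<not> reduced n w"
  shows "divdiff_word w f = 0"
proof -
  obtain w' where w': "set w' \<subseteq> {1..<n}" "word_perm w' = word_perm w" "length w' < length w"
    using assms(3) by (auto simp: reduced_def)
  obtain v where v: "normal_form n v" "contracts w (nf_word n v)"
    using contracts_to_normal_form assms by blast
  obtain v' where v': "normal_form n v'" "contracts w' (nf_word n v')"
    using contracts_to_normal_form w' assms by blast
  have "v = v'"
    using v v' w'(2) assms(2) by (intro normal_form_unique) (auto simp: contracts_def)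
  then have "length (nf_word n v) < length w" using v' w'(3) by (auto simp: contracts_def)
  then show ?thesis using v(2) by (auto simp: contracts_def)
qed

text \<open>Reducedness is tested in \<open>S\<^sub>n\<close> for a possibly larger \<open>n\<close>, as in the definition of \<open>step\<close>.\<close>

lemma normalize_word_reduced:
  assumes "set w \<subseteq> {1..<m}" "1 \<le> m" "m \<le> n" "reduced n w"
  shows "normal_form m (normalize_word m w)"
    and "divdiff_word (nf_word m (normalize_word m w)) = divdiff_word w"
proof -
  obtain v where v: "normal_form m v" "contracts w (nf_word m v)"
    using contracts_to_normal_form assms by blast
  have "set (nf_word m v) \<subseteq> {1..<n}" using set_nf_word[OF v(1)] assms(3) by auto
  \<comment> \<open>A drop in length would make the normal form a shorter word for the same
    permutation, so only the alternative with equal operators remains.\<close>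
  then have "divdiff_word w = divdiff_word (nf_word m v)"
    using v(2) assms(4) unfolding contracts_def reduced_def by metis
  moreover have "normalize_word m w = v"
    unfolding normalize_word_def
    using v assms(2) by (intro the_equality) (auto simp: contracts_def intro: normal_form_unique)
  ultimately show "normal_form m (normalize_word m w)"
    and "divdiff_word (nf_word m (normalize_word m w)) = divdiff_word w"
    using v by simp_all
qed

section \<open>One step of the recursion\<close>

text \<open>This and the next two definitions keep the factors of index at least \<open>q\<close>,
  for a downward induction on \<open>q\<close>; \<open>q = 1\<close> gives \<open>X_pol\<close>,
  \<open>step_word\<close> and \<open>nf_word\<close>.\<close>

definition X_tail :: "nat \<Rightarrow> nat list \<Rightarrow> nat set \<Rightarrow> nat \<Rightarrow> pol" where
  "X_tail N v J q = foldr (\<lambda>q p. delta v J q (Var q * p)) [q..<N] 1"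

definition step_tail :: "nat \<Rightarrow> nat list \<Rightarrow> nat set \<Rightarrow> nat \<Rightarrow> nat list" where
  "step_tail N v J q = concat (map (\<lambda>q. seg (rr J q) (ix v q)) [q..<N])"

definition nf_tail :: "nat \<Rightarrow> nat list \<Rightarrow> nat \<Rightarrow> nat list" where
  "nf_tail N v q = concat (map (\<lambda>j. seg j (ix v j)) [q..<N])"

lemma tail_end [simp]: "X_tail N v J N = 1" "step_tail N v J N = []" "nf_tail N v N = []"
  by (simp_all add: X_tail_def step_tail_def nf_tail_def)

lemma tail_Cons:
  assumes "q < N"
  shows "X_tail N v J q = delta v J q (Var q * X_tail N v J (Suc q))"
    and "step_tail N v J q = seg (rr J q) (ix v q) @ step_tail N v J (Suc q)"
    and "nf_tail N v q = seg q (ix v q) @ nf_tail N v (Suc q)"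
  using assms by (simp_all add: X_tail_def step_tail_def nf_tail_def upt_conv_Cons)

text \<open>Membership of \<open>l\<close> is consulted only at index \<open>l\<close>, so the
  choices \<open>l\<close> in \<open>J\<close> and \<open>l\<close> not in \<open>J\<close> share
  the later factors.\<close>

lemma tail_insert:
  assumes "l < q"
  shows "X_tail N v (insert l J) q = X_tail N v J q"
    and "step_tail N v (insert l J) q = step_tail N v J q"
proof -
  have "delta v (insert l J) k = delta v J k" "rr (insert l J) k = rr J k"
    if "k \<in> set [q..<N]" for k
    using that assms by (auto simp: delta_def rr_def)
  then show "X_tail N v (insert l J) q = X_tail N v J q"
    and "step_tail N v (insert l J) q = step_tail N v J q"
    unfolding X_tail_def step_tail_def
    by (auto simp: set_upt intro!: foldr_cong arg_cong[of _ _ concat])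
qed

lemma swap_vars_delta:
  "Suc k < q \<or> Suc q < k \<Longrightarrow> swap_vars k f = f \<Longrightarrow> swap_vars k (delta v J q f) = delta v J q f"
  using swap_vars_commute[of k q f] by (auto simp: delta_def swap_vars_divdiff_commute)

text \<open>All variables and operators in the tail have index at least \<open>q\<close>, beyond
  both swapped variables.\<close>

lemma swap_vars_X_tail_low:
  assumes "q \<le> N" "Suc k < q"
  shows "swap_vars k (X_tail N v J q) = X_tail N v J q"
  using assms
proof (induction q rule: inc_induct)
  case (step q)
  then show ?case
    by (auto simp: tail_Cons swap_vars_mult swap_vars_Var intro!: swap_vars_delta)
qed simp

text \<open>The critical index is \<open>q = n\<close>: as \<open>n\<close> is not in
  \<open>J\<close>, the innermost factor is \<open>1\<close> or \<open>Var n\<close>, never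
  \<open>Var (Suc n)\<close>. The operators of smaller index commute with the swap at
  \<open>k\<close>.\<close>

lemma swap_vars_X_tail_high:
  assumes "1 \<le> q" "q \<le> Suc n" "J \<subseteq> {1..n - 1}" "n < k"
  shows "swap_vars k (X_tail (Suc n) v J q) = X_tail (Suc n) v J q"
  using assms(2,1,3,4)
proof (induction q rule: inc_induct)
  case (step q)
  show ?case
  proof (cases "q = n")
    case True
    then have "q \<notin> J" using step.prems by auto
    then show ?thesis
      using True step.prems by (simp add: tail_Cons delta_def divdiff_Var swap_vars_Var)
  next
    case False
    then have "swap_vars k (Var q * X_tail (Suc n) v J (Suc q))
        = Var q * X_tail (Suc n) v J (Suc q)"
      using step by (simp add: swap_vars_mult swap_vars_Var)
    then show ?thesis
      using step.hyps step.prems False by (subst (1 2) tail_Cons) (auto intro!: swap_vars_delta)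
  qed
qed simp

text \<open>The transposition permutes the index set unless exactly one of \<open>k\<close> and
  \<open>k + 1\<close> belongs to it.\<close>

lemma swap_vars_prod_Var:
  assumes "1 \<le> k" "Suc k \<noteq> m"
  shows "swap_vars k (\<Prod>j\<in>{1..<m}. Var j) = (\<Prod>j\<in>{1..<m}. Var j)"
proof -
  have prod: "swap_vars k (prod g S) = (\<Prod>j\<in>S. swap_vars k (g j))" for g and S :: "nat set"
    by (induction S rule: infinite_finite_induct) (simp_all add: swap_vars_mult)
  have "bij_betw (transpose k (Suc k)) {1..<m} {1..<m}"
    using assms
    by (intro bij_betw_byWitness[where f' = "transpose k (Suc k)"]) (auto simp: transpose_def)
  then show ?thesis
    unfolding prod swap_vars_Var by (rule prod.reindex_bij_betw)
qed

lemma sum_Pow_insert: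
  assumes "finite S" "q \<notin> S"
  shows "(\<Sum>J\<in>Pow (insert q S). F J) = (\<Sum>J\<in>Pow S. F J + F (insert q J))"
proof -
  have "inj_on (insert q) (Pow S)" "Pow S \<inter> insert q ` Pow S = {}"
    using assms(2) by (auto simp: inj_on_def)
  then show ?thesis
    using assms(1) by (simp add: Pow_insert sum.union_disjoint sum.reindex sum.distrib)
qed

text \<open>Moving the segments from right to left past the product of the variables: since
  \<open>s\<^sub>1, \<dots>, s\<^sub>q\<^sub>-\<^sub>1\<close> fix \<open>x\<^sub>1 \<dots> x\<^sub>q\<close> and all later factors, only \<open>\<partial>\<^sub>q\<close> at the head of a segment
  acts nontrivially, and the two terms of its Leibniz rule are the choices \<open>q \<notin> J\<close> and \<open>q \<in> J\<close>.
  The last segment offers no choice because of the hypothesis on \<open>f\<close>.\<close>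

lemma divdiff_word_nf_tail:
  assumes "1 \<le> q" "q \<le> Suc n" "normal_form (Suc n) v"
    and top: "\<And>i. 1 \<le> i \<Longrightarrow> i \<le> n \<Longrightarrow> divdiff n (divdiff_word (seg (n - 1) i) f) = 0"
  shows "divdiff_word (nf_tail (Suc n) v q) ((\<Prod>k\<in>{1..<Suc n}. Var k) * f)
    = (\<Prod>k\<in>{1..<q}. Var k) * (\<Sum>J\<in>Pow {l \<in> {q..n - 1}. ix v l \<le> l}.
        X_tail (Suc n) v J q * divdiff_word (step_tail (Suc n) v J q) f)"
  using assms(2,1)
proof (induction q rule: inc_induct)
  case base
  have "{l \<in> {Suc n..n - 1}. ix v l \<le> l} = {}" by auto
  then show ?case by (simp only: tail_end Pow_empty) simp
next
  case (step q)
  define i where "i = ix v q"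
  have i_eq: "v ! (q - Suc 0) = i" by (simp add: i_def)
  define P where "P = (\<lambda>q. \<Prod>k\<in>{1..<q}. Var k)"
  define S where "S = (\<lambda>q. {l \<in> {q..n - 1}. ix v l \<le> l})"
  define A where "A = (\<lambda>J. X_tail (Suc n) v J (Suc q))"
  define g where "g = (\<lambda>J. divdiff_word (step_tail (Suc n) v J (Suc q)) f)"
  define h where "h = (\<lambda>J. divdiff_word (seg (q - 1) i) (g J))"
  have q: "1 \<le> q" "q \<le> n" using step by auto
  then have i: "1 \<le> i" "i \<le> Suc q"
    using assms(3) unfolding normal_form_def i_def by auto
  have P: "P (Suc q) = P q * Var q"
    using q unfolding P_def by (simp add: prod.atLeastLessThan_Suc)
  have P_inv: "swap_vars k (P m) = P m" if "1 \<le> k" "Suc k \<noteq> m" for k m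
    unfolding P_def using that by (rule swap_vars_prod_Var)
  have notin: "q \<notin> J" if "J \<in> Pow (S (Suc q))" for J using that by (auto simp: S_def)
  have low: "swap_vars k (A J) = A J" if "k < q" for k J
    unfolding A_def using that q by (intro swap_vars_X_tail_low) auto
  have "divdiff_word (nf_tail (Suc n) v q) (P (Suc n) * f)
      = divdiff_word (seg q i) (P (Suc q) * (\<Sum>J\<in>Pow (S (Suc q)). A J * g J))"
    using step.IH q step.hyps by (simp add: tail_Cons P_def S_def A_def g_def i_def)
  also have "\<dots> = P q * (\<Sum>J\<in>Pow (S q).
      X_tail (Suc n) v J q * divdiff_word (step_tail (Suc n) v J q) f)"
  proof (cases "i \<le> q")
    \<comment> \<open>Here \<open>i = Suc q\<close>: the segment is empty, \<open>q\<close> may not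
      enter \<open>J\<close>, and \<open>delta\<close> is the identity.\<close>
    case False
    then have "S q = S (Suc q)"
      using q by (auto simp: S_def i_def Suc_le_eq order.order_iff_strict)
    moreover have "X_tail (Suc n) v J q = Var q * A J" "step_tail (Suc n) v J q
        = step_tail (Suc n) v J (Suc q)" if "J \<in> Pow (S (Suc q))" for J
      using notin[OF that] q False by (simp_all add: tail_Cons delta_def A_def rr_def i_def)
    ultimately show ?thesis
      using False by (simp add: P g_def sum_distrib_left mult_ac)
  next
    case True
    define T where "T = (\<lambda>J. divdiff q (Var q * A J) * h J)"
    define T' where "T' = (\<lambda>J. swap_vars q (Var q * A J) * divdiff q (h J))"
    have "divdiff_word (seg q i) (P (Suc q) * (\<Sum>J\<in>Pow (S (Suc q)). A J * g J))
        = divdiff q (P (Suc q) * divdiff_word (seg (q - 1) i)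
            (\<Sum>J\<in>Pow (S (Suc q)). A J * g J))"
      using i True unfolding seg_Cons[OF True i(1)] divdiff_word_Cons
      by (subst divdiff_word_mult_invariant) (use i in \<open>auto simp: set_seg intro!: P_inv\<close>)
    also have "divdiff_word (seg (q - 1) i) (\<Sum>J\<in>Pow (S (Suc q)). A J * g J)
        = (\<Sum>J\<in>Pow (S (Suc q)). A J * h J)"
      using i unfolding divdiff_word_sum h_def
      by (intro sum.cong refl divdiff_word_mult_invariant low) (auto simp: set_seg)
    \<comment> \<open>The swap at \<open>q\<close> fixes \<open>P q\<close> but not
      \<open>Var q\<close>, which therefore stays inside and becomes the variable that
      \<open>delta\<close> acts on.\<close>
    also have "divdiff q (P (Suc q) * \<dots>)
        = P q * divdiff q (Var q * (\<Sum>J\<in>Pow (S (Suc q)). A J * h J))"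
      unfolding P mult.assoc using q
      by (intro divdiff_mult_invariant) (simp add: P_inv)
    also have "divdiff q (Var q * (\<Sum>J\<in>Pow (S (Suc q)). A J * h J))
        = (\<Sum>J\<in>Pow (S (Suc q)). T J + T' J)"
      unfolding sum_distrib_left divdiff_sum T_def T'_def mult.assoc[symmetric]
      by (simp only: divdiff_leibniz)
    also have "\<dots> = (\<Sum>J\<in>Pow (S q).
      X_tail (Suc n) v J q * divdiff_word (step_tail (Suc n) v J q) f)"
    proof -
      \<comment> \<open>In \<open>T\<close> the operator is spent on the polynomial factor and the
        letter \<open>q\<close> leaves the word; in \<open>T'\<close> the letter stays and the
        factor is swapped.\<close>
      have T: "T J = X_tail (Suc n) v J q * divdiff_word (step_tail (Suc n) v J q) f"
        if "J \<in> Pow (S (Suc q))" for J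
        using notin[OF that] q True
        by (simp add: T_def tail_Cons delta_def rr_def A_def h_def g_def i_def)
      have T': "T' J = X_tail (Suc n) v (insert q J) q
          * divdiff_word (step_tail (Suc n) v (insert q J) q) f" for J
        using q True i
        by (simp add: T'_def tail_Cons tail_insert delta_def rr_def A_def h_def g_def seg_Cons
            i_eq)
      show ?thesis
      proof (cases "q = n")
        case True
        then have "S (Suc q) = {}" "S q = {}" using q by (auto simp: S_def)
        moreover have "T' {} = 0"
          using top[of i] i \<open>i \<le> q\<close> True by (simp add: T'_def h_def g_def)
        ultimately show ?thesis using T[of "{}"] by simp
      next
        case False
        then have "S q = insert q (S (Suc q))" using q True by (auto simp: S_def i_def)
        moreover have "finite (S (Suc q))" "q \<notin> S (Suc q)" by (auto simp: S_def)
        ultimately show ?thesis using T T' by (simp add: sum_Pow_insert)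
      qed
    qed
    finally show ?thesis .
  qed
  finally show ?case by (simp add: P_def S_def)
qed

text \<open>The last segment starts at \<open>n - 1\<close> because \<open>n\<close> is not in
  \<open>J\<close>; hence one step leads from \<open>Suc n\<close> down to \<open>n\<close>.\<close>

lemma set_step_word:
  assumes "n \<ge> 1" "normal_form (Suc n) u" "J \<in> allowed (Suc n) u"
  shows "set (step_word (Suc n) u J) \<subseteq> {1..<n}"
proof
  fix k assume "k \<in> set (step_word (Suc n) u J)"
  then obtain q where q: "q \<in> {1..<Suc n}" "ix u q \<le> k" "k \<le> rr J q"
    by (auto simp: step_word_def set_seg simp del: upt_Suc)
  then have "q \<in> {1..Suc n - 1}" by auto
  then have "1 \<le> ix u q" using assms(2) unfolding normal_form_def by blast
  moreover have "rr J q < n"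
    using q assms(1,3) by (cases "q = n") (auto simp: rr_def allowed_def)
  ultimately show "k \<in> {1..<n}" using q by auto
qed

section \<open>Recursion for the divided differences of the staircase monomial\<close>

lemma schubert_w0_Suc: "schubert_w0 (Suc n) = (\<Prod>k\<in>{1..<Suc n}. Var k) * schubert_w0 n"
proof -
  \<comment> \<open>The range can be extended to \<open>k = n\<close>, where the exponent is
    \<open>0\<close>.\<close>
  have "schubert_w0 n = (\<Prod>k\<in>{1..<Suc n}. Var k ^ (n - k))"
    unfolding schubert_w0_def by (rule prod.mono_neutral_left) auto
  moreover have "schubert_w0 (Suc n) = (\<Prod>k\<in>{1..<Suc n}. Var k * Var k ^ (n - k))"
    unfolding schubert_w0_def by (rule prod.cong) (auto simp: Suc_diff_le)
  ultimately show ?thesis by (simp only: prod.distrib)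
qed

text \<open>Invariance under all \<open>s\<^sub>k\<close> with \<open>k \<ge> n\<close> expresses that the Schubert polynomials of \<open>S\<^sub>n\<close>
  only involve \<open>x\<^sub>1, \<dots>, x\<^sub>n\<^sub>-\<^sub>1\<close>.\<close>

definition low_vars :: "nat \<Rightarrow> bool" where
  "low_vars n \<longleftrightarrow> (\<forall>v k. normal_form n v \<longrightarrow> n \<le> k \<longrightarrow>
    swap_vars k (divdiff_word (nf_word n v) (schubert_w0 n))
      = divdiff_word (nf_word n v) (schubert_w0 n))"

text \<open>Every word acts as \<open>0\<close> or as its normal form.\<close>

lemma low_vars_word:
  assumes "low_vars n" "n \<ge> 1" "set w \<subseteq> {1..<n}" "n \<le> k"
  shows "swap_vars k (divdiff_word w (schubert_w0 n)) = divdiff_word w (schubert_w0 n)"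
proof -
  obtain v where "normal_form n v" "contracts w (nf_word n v)"
    using contracts_to_normal_form assms by blast
  then show ?thesis using assms(1,4) by (auto simp: contracts_def low_vars_def)
qed

lemma divdiff_word_schubert_step:
  assumes "low_vars n" "n \<ge> 1" "normal_form (Suc n) u"
  shows "divdiff_word (nf_word (Suc n) u) (schubert_w0 (Suc n))
    = (\<Sum>J\<in>allowed (Suc n) u.
        X_pol (Suc n) u J * divdiff_word (step_word (Suc n) u J) (schubert_w0 n))"
proof -
  \<comment> \<open>The vanishing hypothesis of \<open>divdiff_word_nf_tail\<close>: by
    \<open>low_vars n\<close> the inner polynomial is invariant under the swap at
    \<open>n\<close>.\<close>
  have "divdiff n (divdiff_word (seg (n - 1) i) (schubert_w0 n)) = 0" if "1 \<le> i" "i \<le> n" for i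
    using assms(1,2) that by (intro divdiff_invariant low_vars_word) (auto simp: set_seg)
  then show ?thesis
    using divdiff_word_nf_tail[of 1 n u "schubert_w0 n"] assms(3)
    by (simp add: schubert_w0_Suc nf_word_def nf_tail_def allowed_def X_pol_def X_tail_def
        step_word_def step_tail_def)
qed

text \<open>The invariance for \<open>n\<close> yields the one-step formula for
  \<open>Suc n\<close>, and each factor in that formula is invariant under the swaps at
  \<open>k > n\<close>.\<close>

lemma low_vars: "n \<ge> 1 \<Longrightarrow> low_vars n"
proof (induction n rule: dec_induct)
  case base
  show ?case by (simp add: low_vars_def schubert_w0_def)
next
  case (step n)
  have "swap_vars k (X_pol (Suc n) v J) = X_pol (Suc n) v J"
    if "J \<in> allowed (Suc n) v" "Suc n \<le> k" for v J k
  proof -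
    have "J \<subseteq> {1..n - 1}" using that by (auto simp: allowed_def)
    then show ?thesis
      using swap_vars_X_tail_high[of 1 n J k v] that(2) unfolding X_pol_def X_tail_def by simp
  qed
  moreover have "swap_vars k (divdiff_word (step_word (Suc n) v J) (schubert_w0 n))
      = divdiff_word (step_word (Suc n) v J) (schubert_w0 n)"
    if "normal_form (Suc n) v" "J \<in> allowed (Suc n) v" "Suc n \<le> k" for v J k
    using low_vars_word[OF step.IH _ set_step_word] step.hyps that by simp
  ultimately show ?case
    using step unfolding low_vars_def[of "Suc n"]
    by (simp add: divdiff_word_schubert_step swap_vars_sum swap_vars_mult)
qed

section \<open>Iteration\<close>

lemma iter_append_defined: "iter n u (xs @ ys) \<noteq> None \<Longrightarrow> iter n u xs \<noteq> None"
  by (induction n u xs rule: iter.induct) (auto split: option.splits)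

text \<open>Prefixes of a sequence with a defined result also have one, so testing the full sequence
  suffices.\<close>

lemma J_seqs_eq:
  assumes "n \<ge> 1"
  shows "J_seqs n u = {Js. length Js = n - 1 \<and> iter n u Js \<noteq> None}"
proof (intro set_eqI iffI)
  fix Js assume Js: "Js \<in> J_seqs n u"
  then have len: "length Js = n - 1" by (simp add: J_seqs_def)
  have "iter n u Js \<noteq> None"
  proof (cases "n = 1")
    case False
    then have "1 \<in> {1..n - 1}" using assms by simp
    then have "iter n u (take (n - 1) Js) \<noteq> None" using Js unfolding J_seqs_def by blast
    then show ?thesis using len by simp
  qed (use len in simp)
  then show "Js \<in> {Js. length Js = n - 1 \<and> iter n u Js \<noteq> None}" using len by simp
next
  fix Js assume Js: "Js \<in> {Js. length Js = n - 1 \<and> iter n u Js \<noteq> None}"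
  then have "iter n u (take k Js) \<noteq> None" for k
    using iter_append_defined[of n u "take k Js" "drop k Js"] by simp
  with Js show "Js \<in> J_seqs n u" unfolding J_seqs_def by blast
qed

lemma J_seqs_1: "J_seqs (Suc 0) u = {[]}"
  by (auto simp: J_seqs_eq)

lemma J_seqs_Suc:
  assumes "n \<ge> 1"
  shows "J_seqs (Suc n) u =
    (\<Union>J\<in>{J. step (Suc n) u J \<noteq> None}. (#) J ` J_seqs n (the (step (Suc n) u J)))"
proof (intro set_eqI)
  fix Js
  show "Js \<in> J_seqs (Suc n) u \<longleftrightarrow>
    Js \<in> (\<Union>J\<in>{J. step (Suc n) u J \<noteq> None}. (#) J ` J_seqs n (the (step (Suc n) u J)))"
    using assms by (cases Js) (auto simp: J_seqs_eq split: option.splits)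
qed

lemma X_prod_Cons:
  assumes "n \<ge> 1" "step (Suc n) u J = Some v"
  shows "X_prod (Suc n) u (J # Js) = X_pol (Suc n) u J * X_prod n v Js"
proof -
  obtain m where "n = Suc m" using assms(1) by (cases n) auto
  then show ?thesis using assms(2) by (simp add: X_prod_def prod.lessThan_Suc_shift
        del: prod.lessThan_Suc)
qed

lemma sum_J_seqs_Suc:
  assumes "n \<ge> 1"
  shows "(\<Sum>Js\<in>J_seqs (Suc n) u. X_prod (Suc n) u Js)
    = (\<Sum>J | step (Suc n) u J \<noteq> None.
        X_pol (Suc n) u J * (\<Sum>Js\<in>J_seqs n (the (step (Suc n) u J)).
          X_prod n (the (step (Suc n) u J)) Js))"
proof -
  have "{J. step (Suc n) u J \<noteq> None} \<subseteq> Pow {1..n}"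
    by (auto simp: step_def allowed_def split: if_splits)
  then have "finite {J. step (Suc n) u J \<noteq> None}" by (rule finite_subset) simp
  then have "(\<Sum>Js\<in>J_seqs (Suc n) u. X_prod (Suc n) u Js)
      = (\<Sum>J | step (Suc n) u J \<noteq> None.
          \<Sum>Js\<in>(#) J ` J_seqs n (the (step (Suc n) u J)). X_prod (Suc n) u Js)"
    unfolding J_seqs_Suc[OF assms]
    by (intro sum.UNION_disjoint) (auto simp: finite_J_seqs)
  also have "\<dots> = (\<Sum>J | step (Suc n) u J \<noteq> None.
      X_pol (Suc n) u J * (\<Sum>Js\<in>J_seqs n (the (step (Suc n) u J)).
        X_prod n (the (step (Suc n) u J)) Js))"
    using assms by (intro sum.cong) (auto simp: sum.reindex X_prod_Cons sum_distrib_left)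
  finally show ?thesis .
qed

theorem theorem1:
  fixes n :: nat and u :: "nat list"
  assumes "n \<ge> 2" and "normal_form n u"
  shows "divdiff_word (nf_word n u) (schubert_w0 n) = (\<Sum>Js\<in>J_seqs n u. X_prod n u Js)"
proof -
  have "1 \<le> n" using assms(1) by simp
  then show ?thesis using assms(2)
  proof (induction n arbitrary: u rule: dec_induct)
    \<comment> \<open>The induction starts at \<open>n = 1\<close>, where the empty sequence is the
      only one and both sides are \<open>1\<close>.\<close>
    case base
    then show ?case by (simp add: J_seqs_1 X_prod_def schubert_w0_def)
  next
    case (step n)
    let ?D = "\<lambda>J. divdiff_word (step_word (Suc n) u J) (schubert_w0 n)"
    have "divdiff_word (nf_word (Suc n) u) (schubert_w0 (Suc n))
        = (\<Sum>J\<in>allowed (Suc n) u. X_pol (Suc n) u J * ?D J)"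
      using step by (intro divdiff_word_schubert_step low_vars)
    also have "\<dots> = (\<Sum>J | step (Suc n) u J \<noteq> None. X_pol (Suc n) u J * ?D J)"
    \<comment> \<open>A choice with undefined result contributes \<open>0\<close>: either
      \<open>X_pol\<close> vanishes or the word is not reduced and acts as \<open>0\<close>.\<close>
    proof (rule sum.mono_neutral_right)
      show "finite (allowed (Suc n) u)" by (simp add: allowed_def)
      show "{J. step (Suc n) u J \<noteq> None} \<subseteq> allowed (Suc n) u"
        by (auto simp: step_def split: if_splits)
      show "\<forall>J\<in>allowed (Suc n) u - {J. step (Suc n) u J \<noteq> None}. X_pol (Suc n) u J * ?D J = 0"
      proof
        fix J assume J: "J \<in> allowed (Suc n) u - {J. step (Suc n) u J \<noteq> None}"
        then have "X_pol (Suc n) u J = 0 \<or> \<not> reduced (Suc n) (step_word (Suc n) u J)"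
          by (auto simp: step_def split: if_splits)
        moreover have "set (step_word (Suc n) u J) \<subseteq> {1..<Suc n}"
          using set_step_word[OF step.hyps(1) step.prems, of J] J by force
        ultimately show "X_pol (Suc n) u J * ?D J = 0"
          using divdiff_word_not_reduced[of "step_word (Suc n) u J" "Suc n"] by auto
      qed
    qed
    also have "\<dots> = (\<Sum>J | step (Suc n) u J \<noteq> None.
        X_pol (Suc n) u J * (\<Sum>Js\<in>J_seqs n (the (step (Suc n) u J)).
          X_prod n (the (step (Suc n) u J)) Js))"
    proof (intro sum.cong refl)
      fix J assume "J \<in> {J. step (Suc n) u J \<noteq> None}"
      then have J: "J \<in> allowed (Suc n) u" "reduced (Suc n) (step_word (Suc n) u J)"
          "the (step (Suc n) u J) = normalize_word n (step_word (Suc n) u J)"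
        by (auto simp: step_def split: if_splits)
      \<comment> \<open>The letters lie below \<open>n\<close>, whereas reducedness is known with
        respect to \<open>Suc n\<close>.\<close>
      note nf = normalize_word_reduced[OF set_step_word[OF step.hyps(1) step.prems J(1)]
          step.hyps(1) _ J(2), simplified, folded J(3)]
      show "X_pol (Suc n) u J * ?D J = X_pol (Suc n) u J
          * (\<Sum>Js\<in>J_seqs n (the (step (Suc n) u J)). X_prod n (the (step (Suc n) u J)) Js)"
        using step.IH[OF nf(1)] nf(2) by simp
    qed
    also have "\<dots> = (\<Sum>Js\<in>J_seqs (Suc n) u. X_prod (Suc n) u Js)"
      by (rule sum_J_seqs_Suc[OF step.hyps(1), symmetric])
    finally show ?case .
  qed
qed

end
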